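(* Let $f,g:I\to\mathbb{R}^n$ be $n$-times continuously differentiable functions such that $W_f$ and $W_g$ are nonvanishing on $I$. Then $f\sim g$ (that is, $f$ and $g$ are range equivalent) holds if and only if $$\Phi_f^{[j]}=\Phi_g^{[j]}\quad\text{on } I\qquad(j\in\{0,\dots,n-1\}).$$
   Context: $n$ is a positive integer, $\mathbb{N}_0$ denotes the nonnegative integers, and $I$ is a nonempty open real interval. For a sufficiently smooth $f:I\to\mathbb{R}^n$ and $k=(k_1,\dots,k_n)\in\mathbb{N}_0^n$, the generalized Wronskian $W_f^k:I\to\mathbb{R}$ is the determinant $W_f^k:=\begin{vmatrix}f^{(k_1)}&\dots&f^{(k_n)}\end{vmatrix}$ of the matrix with columns $f^{(k_1)},\dots,f^{(k_n)}$, and $W_f:=W_f^{(n-1,n-2,\dots,0)}$ is the Wronskian. For an $n$-times continuously differentiable $f:I\to\mathbb{R}^n$ with nonvanishing $W_f$ and $j\in\{0,\dots,n-1\}$, the function $\Phi_f^{[j]}:I\to\mathbb{R}$ is $$\Phi_f^{[j]}:=(-1)^{n-j-1}\frac{W_f^{(n,\dots,j+1,j-1,\dots,0)}}{W_f},$$ where $(n,\dots,j+1,j-1,\dots,0)$ is the decreasing list of all integers from $n$ to $0$ with $j$ omitted. Two continuous functions $f,g:I\to\mathbb{R}^n$ are range equivalent, denoted $f\sim g$, if there exists a nonsingular real $n\times n$ matrix $A$ such that $f=Ag$, i.e. $f(t)=A\,g(t)$ for all $t\in I$. *)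

theory Defs
  imports "HOL-Analysis.Analysis"
begin

text \<open>
  Vectors in \<open>\<real>\<^sup>n\<close> are elements of \<open>real ^ 'n\<close> with \<open>n = CARD('n)\<close>. The index type is linearly
  ordered, so that tuples, rows and columns have a first, second, ... entry. All functions are
  total on \<open>real\<close>; since derivatives are only used at points of an open set \<open>I\<close>, the values
  outside \<open>I\<close> are irrelevant.
\<close>

definition higher_vderiv :: "nat \<Rightarrow> (real \<Rightarrow> 'a::real_normed_vector) \<Rightarrow> real \<Rightarrow> 'a" where
  "higher_vderiv k f = ((\<lambda>g t. vector_derivative g (at t)) ^^ k) f"

text \<open>Intended for open \<open>I\<close>, as the derivatives are two-sided.\<close>

definition cont_differentiable_on ::
    "nat \<Rightarrow> (real \<Rightarrow> 'a::real_normed_vector) \<Rightarrow> real set \<Rightarrow> bool" where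
  "cont_differentiable_on m f I \<longleftrightarrow>
     (\<forall>k<m. \<forall>t\<in>I. higher_vderiv k f differentiable (at t)) \<and>
     continuous_on I (higher_vderiv m f)"

text \<open>The tuple with entries \<open>xs ! 0, xs ! 1, \<dots>\<close> in the order of the index type;
  \<open>card {..<i}\<close> is the zero-based position of \<open>i\<close>.\<close>

definition tuple_of_list :: "'a list \<Rightarrow> 'a ^ ('n::{finite,linorder})" where
  "tuple_of_list xs = (\<chi> i. xs ! card {..<i})"

text \<open>In \<open>\<chi> r c. _\<close> the first index is the row, so column \<open>c\<close> below is the
  derivative of \<open>f\<close> of order \<open>k $ c\<close>.\<close>

definition gen_wronskian ::
    "nat ^ ('n::{finite,linorder}) \<Rightarrow> (real \<Rightarrow> real ^ ('n::{finite,linorder})) \<Rightarrow> real \<Rightarrow> real" where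
  "gen_wronskian k f t = det (\<chi> r c. higher_vderiv (k $ c) f t $ r)"

definition wronskian :: "(real \<Rightarrow> real ^ ('n::{finite,linorder})) \<Rightarrow> real \<Rightarrow> real" where
  "wronskian f = gen_wronskian (tuple_of_list (rev [0..<CARD('n)])) f"

definition Phi :: "nat \<Rightarrow> (real \<Rightarrow> real ^ ('n::{finite,linorder})) \<Rightarrow> real \<Rightarrow> real" where
  "Phi j f t =
     (-1) ^ (CARD('n) - j - 1) *
       (gen_wronskian (tuple_of_list (rev (removeAll j [0..<Suc CARD('n)]))) f t / wronskian f t)"

definition range_equivalent_on ::
    "real set \<Rightarrow> (real \<Rightarrow> real ^ 'n) \<Rightarrow> (real \<Rightarrow> real ^ 'n) \<Rightarrow> bool" where
  "range_equivalent_on I f g \<longleftrightarrow>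
     (\<exists>A :: real ^ 'n ^ 'n. invertible A \<and> (\<forall>t\<in>I. f t = A *v g t))"

end

theory Submission
  imports Defs
begin

text \<open>
  The functions \<open>\<Phi>\<^sub>f\<^sup>j\<close> are the coefficients of the linear differential equation
  \<open>y^(n) = \<Sum>\<^sub>j\<^sub><\<^sub>n \<Phi>\<^sub>f\<^sup>j y^(j)\<close> whose solution space is spanned by the components of \<open>f\<close>. Since
  the Wronskian does not vanish, \<open>f, f', \<dots>, f^(n-1)\<close> form a basis at every point, and expanding
  \<open>f^(n)\<close> in this basis by Cramer's rule produces exactly these coefficients; the sign in
  their definition accounts for moving the substituted column \<open>f^(n)\<close> to the front
  (\<open>top_derivative_eq_sum_Phi\<close>).

  If \<open>f = A g\<close>, then every generalized Wronskian of order at most \<open>n\<close> of \<open>f\<close> is \<open>det A\<close> times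
  that of \<open>g\<close>, and the factor cancels in the quotient (\<open>Phi_linear_image\<close>).

  Conversely, if the coefficients agree, each component of \<open>f\<close> solves the equation of \<open>g\<close>, and
  it remains to see that it is a constant combination of the components of \<open>g\<close>
  (\<open>ode_solution_linear_combination\<close>). This is done by variation of constants rather than by a
  uniqueness theorem: at each \<open>t\<close> there is a unique vector \<open>a(t)\<close> with
  \<open>u^(k) = g^(k) \<bullet> a\<close> for all \<open>k < n\<close>, it depends differentiably on \<open>t\<close> by Cramer's rule, and
  the differential equation extends the relation to \<open>k = n\<close>. Differentiating the relations for
  \<open>k < n\<close> leaves \<open>g^(k) \<bullet> a' = 0\<close>, so that \<open>a' = 0\<close>.
\<close>

section \<open>Columns listed by decreasing order of differentiation\<close>

text \<open>
  The order of differentiation in column \<open>c\<close> of the Wronskian, whose first column is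
  \<open>f^(n-1)\<close> and whose last one is \<open>f\<close>. Naming columns by this number instead of their position
  turns statements about the index type into statements about \<open>{..<n}\<close>.
\<close>

definition deriv_order :: "'n::{finite,linorder} \<Rightarrow> nat" where
  "deriv_order c = CARD('n) - 1 - card {..<c}"

lemma card_lessThan_less: "card {..<c::'n::{finite,linorder}} < CARD('n)"
  by (intro psubset_card_mono) auto

lemma deriv_order_less: "deriv_order (c::'n::{finite,linorder}) < CARD('n)"
  using card_lessThan_less[of c] by (simp add: deriv_order_def)

lemma inj_deriv_order: "inj (deriv_order :: 'n::{finite,linorder} \<Rightarrow> nat)"
proof (rule injI)
  fix c d :: 'n
  assume "deriv_order c = deriv_order d"
  then have eq: "card {..<c} = card {..<d}"
    using card_lessThan_less[of c] card_lessThan_less[of d] by (simp add: deriv_order_def)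
  have "card {..<a} < card {..<b}" if "a < b" for a b :: 'n
    using that by (intro psubset_card_mono) auto
  with eq show "c = d"
    by (metis less_irrefl neqE)
qed

lemma bij_betw_deriv_order:
  "bij_betw (deriv_order :: 'n::{finite,linorder} \<Rightarrow> nat) UNIV {..<CARD('n)}"
proof -
  have "card (range (deriv_order :: 'n \<Rightarrow> nat)) = CARD('n)"
    using inj_deriv_order by (rule card_image)
  moreover have "range (deriv_order :: 'n \<Rightarrow> nat) \<subseteq> {..<CARD('n)}"
    using deriv_order_less by auto
  ultimately have "range (deriv_order :: 'n \<Rightarrow> nat) = {..<CARD('n)}"
    by (intro card_subset_eq) auto
  with inj_deriv_order show ?thesis
    by (simp add: bij_betw_def)
qed

lemma deriv_order_surj:
  assumes "j < CARD('n::{finite,linorder})"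
  obtains c :: "'n::{finite,linorder}" where "deriv_order c = j"
  using bij_betw_deriv_order[where 'n = 'n] assms
  by (metis bij_betw_imp_surj_on imageE lessThan_iff)

lemma tuple_wronskian:
  "tuple_of_list (rev [0..<CARD('n)]) $ (c::'n::{finite,linorder}) = deriv_order c"
  using card_lessThan_less[of c]
  by (simp add: tuple_of_list_def rev_nth deriv_order_def)

text \<open>
  Omitting \<open>j\<close> from \<open>n, \<dots>, 0\<close> amounts to raising the orders of the Wronskian's columns from \<open>j\<close>
  on by one. In this form the determinants for different \<open>j\<close> share the
  column indexing of the Wronskian.
\<close>

lemma tuple_omitting:
  assumes "j < CARD('n)"
  shows "tuple_of_list (rev (removeAll j [0..<Suc CARD('n)])) $ (c::'n::{finite,linorder}) =
    (if deriv_order c < j then deriv_order c else Suc (deriv_order c))"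
proof -
  have "[0..<Suc CARD('n)] = [0..<j] @ [j..<Suc CARD('n)]"
    using assms upt_add_eq_append[of 0 j "Suc CARD('n) - j"] by simp
  also have "[j..<Suc CARD('n)] = j # [Suc j..<Suc CARD('n)]"
    using assms by (intro upt_conv_Cons) simp
  finally have "removeAll j [0..<Suc CARD('n)] = [0..<j] @ [Suc j..<Suc CARD('n)]"
    by simp
  then show ?thesis
    using card_lessThan_less[of c] assms
    by (auto simp: tuple_of_list_def rev_nth nth_append deriv_order_def simp del: upt_Suc)
qed

definition cols ::
    "(nat \<Rightarrow> real ^ ('n::{finite,linorder})) \<Rightarrow> real ^ ('n::{finite,linorder}) ^ ('n::{finite,linorder})" where
  "cols v = (\<chi> r c. v (deriv_order c) $ r)"

lemma cols_cong:
  fixes v w :: "nat \<Rightarrow> real ^ 'n::{finite,linorder}"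
  shows "(\<And>e. e < CARD('n) \<Longrightarrow> v e = w e) \<Longrightarrow> cols v = cols w"
  by (simp add: cols_def deriv_order_less)

lemma matrix_mult_cols: "A ** cols v = cols (\<lambda>e. A *v v e)"
  by (simp add: cols_def matrix_matrix_mult_def matrix_vector_mult_def vec_eq_iff)

lemma cols_mult_vec:
  fixes v :: "nat \<Rightarrow> real ^ 'n::{finite,linorder}"
  shows "cols v *v (\<chi> c. x (deriv_order c)) = (\<Sum>e<CARD('n). x e *\<^sub>R v e)"
proof -
  have "cols v *v (\<chi> c. x (deriv_order c)) =
      (\<Sum>c\<in>(UNIV :: 'n set). x (deriv_order c) *\<^sub>R v (deriv_order c))"
    by (simp add: vec_eq_iff matrix_vector_mult_def cols_def mult.commute)
  also have "\<dots> = (\<Sum>e<CARD('n). x e *\<^sub>R v e)"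
    by (rule sum.reindex_bij_betw[OF bij_betw_deriv_order])
  finally show ?thesis .
qed

text \<open>
  The transpose turns a system of equations \<open>v\<^sub>e \<bullet> x = b\<^sub>e\<close> into a single matrix equation for \<open>x\<close>,
  the shape to which Cramer's rule applies.
\<close>

lemma transpose_cols_mult_vec:
  "Finite_Cartesian_Product.transpose (cols v) *v x = (\<chi> c. v (deriv_order c) \<bullet> x)"
  by (simp add: vec_eq_iff matrix_vector_mult_def cols_def transpose_def inner_vec_def)

lemma orthogonal_to_columns_imp_zero:
  fixes v :: "nat \<Rightarrow> real ^ 'n::{finite,linorder}"
  assumes "det (cols v) \<noteq> 0" and "\<And>e. e < CARD('n) \<Longrightarrow> v e \<bullet> x = 0"
  shows "x = 0"
proof -
  let ?M = "Finite_Cartesian_Product.transpose (cols v)"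
  have "?M *v x = 0"
    unfolding transpose_cols_mult_vec using assms(2) by (simp add: deriv_order_less vec_eq_iff)
  then have "x = (\<chi> k. det (\<chi> i j. if j = k then 0 $ i else ?M $ i $ j) / det ?M)"
    using assms(1) cramer[of ?M x 0] by (simp add: det_transpose)
  moreover have "0 = (\<chi> k. det (\<chi> i j. if j = k then 0 $ i else ?M $ i $ j) / det ?M)"
    using assms(1) cramer[of ?M 0 0] by (simp add: det_transpose)
  ultimately show ?thesis
    by simp
qed

lemma wronskian_eq_det_cols: "wronskian f t = det (cols (\<lambda>e. higher_vderiv e f t))"
  unfolding wronskian_def gen_wronskian_def cols_def tuple_wronskian ..

lemma gen_wronskian_omitting:
  fixes f :: "real \<Rightarrow> real ^ 'n::{finite,linorder}"
  assumes "j < CARD('n)"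
  shows "gen_wronskian (tuple_of_list (rev (removeAll j [0..<Suc CARD('n)]))) f t =
    det (cols (\<lambda>e. higher_vderiv (if e < j then e else Suc e) f t))"
  unfolding gen_wronskian_def cols_def tuple_omitting[OF assms] ..

lemma Phi_eq_det_cols:
  fixes f :: "real \<Rightarrow> real ^ 'n::{finite,linorder}"
  assumes "j < CARD('n)"
  shows "Phi j f t = (-1) ^ (CARD('n) - j - 1) *
    (det (cols (\<lambda>e. higher_vderiv (if e < j then e else Suc e) f t)) /
      det (cols (\<lambda>e. higher_vderiv e f t)))"
  unfolding Phi_def gen_wronskian_omitting[OF assms] wronskian_eq_det_cols ..

section \<open>Cramer's rule with an omitted column\<close>

lemma det_cols_swap_adjacent:
  fixes v w :: "nat \<Rightarrow> real ^ 'n::{finite,linorder}"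
  assumes "Suc m < CARD('n)"
    and "w m = v (Suc m)" "w (Suc m) = v m" "\<And>e. e \<noteq> m \<Longrightarrow> e \<noteq> Suc m \<Longrightarrow> w e = v e"
  shows "det (cols w) = - det (cols v)"
proof -
  obtain a :: 'n where a: "deriv_order a = m"
    using deriv_order_surj assms(1) Suc_lessD by metis
  obtain b :: 'n where b: "deriv_order b = Suc m"
    using deriv_order_surj assms(1) by metis
  have "a \<noteq> b"
    using a b by auto
  define p where "p = Transposition.transpose a b"
  have p: "p permutes UNIV"
    unfolding p_def by (rule permutes_swap_id) auto
  have "w (deriv_order c) = v (deriv_order (p c))" for c
  proof (cases "c = a \<or> c = b")
    case True
    then show ?thesis
      using a b assms(2,3) by (auto simp: p_def)
  next
    case False
    then have "deriv_order c \<noteq> m" "deriv_order c \<noteq> Suc m"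
      using a b inj_deriv_order by (metis injD)+
    with False show ?thesis
      by (simp add: p_def assms(4) transpose_apply_other)
  qed
  then have "cols w = (\<chi> r c. cols v $ r $ p c)"
    by (simp add: cols_def)
  then have "det (cols w) = of_int (sign p) * det (cols v)"
    using det_permute_columns[OF p, of "cols v"] by simp
  with \<open>a \<noteq> b\<close> show ?thesis
    by (simp add: p_def sign_swap_id)
qed

text \<open>
  Replacing column \<open>j\<close> by \<open>v\<^sub>n\<close> gives the columns \<open>v\<^sub>n, \<dots>, v\<^sub>0\<close> without \<open>v\<^sub>j\<close> up to order: \<open>v\<^sub>n\<close> stands
  at the place of \<open>v\<^sub>j\<close> and has to move to the front past the \<open>n - j - 1\<close> columns
  \<open>v\<^sub>j\<^sub>+\<^sub>1, \<dots>, v\<^sub>n\<^sub>-\<^sub>1\<close>, each step being an adjacent transposition.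
\<close>

lemma det_cols_omitting:
  fixes v :: "nat \<Rightarrow> real ^ 'n::{finite,linorder}"
  assumes "j < CARD('n)"
  shows "det (cols (v(j := v CARD('n)))) =
    (-1) ^ (CARD('n) - j - 1) * det (cols (\<lambda>e. v (if e < j then e else Suc e)))"
proof -
  \<comment> \<open>the columns once \<open>v\<^sub>n\<close> has moved from place \<open>j\<close> to place \<open>m\<close>\<close>
  define s where "s m e =
    (if e < j then v e else if e < m then v (Suc e) else if e = m then v CARD('n) else v e)" for m e
  have step: "det (cols (s (j + k))) = (-1) ^ k * det (cols (s j))" if "j + k < CARD('n)" for k
    using that
  proof (induction k)
    case (Suc k)
    have "det (cols (s (j + Suc k))) = - det (cols (s (j + k)))"
      by (rule det_cols_swap_adjacent[where m = "j + k"]) (use Suc.prems in \<open>auto simp: s_def\<close>)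
    with Suc show ?case
      by simp
  qed simp
  have "cols (s j) = cols (v(j := v CARD('n)))"
    by (rule cols_cong) (auto simp: s_def)
  moreover have "cols (s (j + (CARD('n) - j - 1))) = cols (\<lambda>e. v (if e < j then e else Suc e))"
  proof (rule cols_cong)
    fix e assume "e < CARD('n)"
    then have "e < CARD('n) - 1 \<or> Suc e = CARD('n)"
      by auto
    then show "s (j + (CARD('n) - j - 1)) e = v (if e < j then e else Suc e)"
      using assms by (auto simp: s_def)
  qed
  ultimately show ?thesis
    using step[of "CARD('n) - j - 1"] assms by simp
qed

lemma cramer_omitting:
  fixes v :: "nat \<Rightarrow> real ^ 'n::{finite,linorder}"
  assumes "det (cols v) \<noteq> 0"
  shows "v CARD('n) = (\<Sum>j<CARD('n). ((-1) ^ (CARD('n) - j - 1) *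
    (det (cols (\<lambda>e. v (if e < j then e else Suc e))) / det (cols v))) *\<^sub>R v j)"
    (is "_ = (\<Sum>j<_. ?x j *\<^sub>R _)")
proof -
  have "(\<chi> i c. if c = k then v CARD('n) $ i else cols v $ i $ c) =
      cols (v(deriv_order k := v CARD('n)))" for k :: 'n
    using inj_deriv_order by (auto simp: cols_def vec_eq_iff dest: injD)
  then have "(\<chi> k. ?x (deriv_order k)) =
      (\<chi> k. det (\<chi> i c. if c = k then v CARD('n) $ i else cols v $ i $ c) / det (cols v))"
    by (simp add: det_cols_omitting deriv_order_less)
  then have "cols v *v (\<chi> k. ?x (deriv_order k)) = v CARD('n)"
    by (rule cramer[OF assms, THEN iffD2])
  then show ?thesis
    unfolding cols_mult_vec[of v ?x] by (rule sym)
qed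

text \<open>
  Cramer's rule in the basis \<open>f, \<dots>, f^(n-1)\<close>. Read as an equation in \<open>t\<close>, it is the linear
  differential equation of order \<open>n\<close> that determines \<open>f\<close> up to range equivalence.
\<close>

lemma top_derivative_eq_sum_Phi:
  fixes f :: "real \<Rightarrow> real ^ 'n::{finite,linorder}"
  assumes "wronskian f t \<noteq> 0"
  shows "higher_vderiv CARD('n) f t = (\<Sum>j<CARD('n). Phi j f t *\<^sub>R higher_vderiv j f t)"
  using cramer_omitting[of "\<lambda>e. higher_vderiv e f t"] assms
  by (simp add: Phi_eq_det_cols wronskian_eq_det_cols)

section \<open>Derivatives\<close>

lemma higher_vderiv_has_vector_derivative:
  assumes "cont_differentiable_on m f I" "k < m" "t \<in> I"
  shows "(higher_vderiv k f has_vector_derivative higher_vderiv (Suc k) f t) (at t)"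
  using assms by (simp add: cont_differentiable_on_def higher_vderiv_def vector_derivative_works)

lemma higher_vderiv_linear_image:
  fixes f g :: "real \<Rightarrow> real ^ 'n" and A :: "real ^ 'n ^ 'n"
  assumes I: "open I" and g: "cont_differentiable_on m g I"
    and fg: "\<forall>t\<in>I. f t = A *v g t" and "k \<le> m" "t \<in> I"
  shows "higher_vderiv k f t = A *v higher_vderiv k g t"
  using \<open>k \<le> m\<close> \<open>t \<in> I\<close>
proof (induction k arbitrary: t)
  case 0
  then show ?case
    using fg by (simp add: higher_vderiv_def)
next
  case (Suc k)
  have "((\<lambda>s. A *v higher_vderiv k g s) has_vector_derivative A *v higher_vderiv (Suc k) g t) (at t)"
    using Suc.prems g
    by (intro bounded_linear.has_vector_derivative[OF matrix_vector_mul_bounded_linear]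
        higher_vderiv_has_vector_derivative) auto
  then have "(higher_vderiv k f has_vector_derivative A *v higher_vderiv (Suc k) g t) (at t)"
    using Suc by (elim has_vector_derivative_transform_within_open[OF _ I]) auto
  then show ?case
    by (simp add: higher_vderiv_def vector_derivative_at)
qed

text \<open>
  All orders that occur are at most \<open>n\<close>, so \<open>A\<close> can be pulled out of every column; numerator and
  denominator then both acquire the factor \<open>det A\<close>.
\<close>

lemma Phi_linear_image:
  fixes f g :: "real \<Rightarrow> real ^ 'n::{finite,linorder}"
    and A :: "real ^ ('n::{finite,linorder}) ^ ('n::{finite,linorder})"
  assumes "open I" and "cont_differentiable_on CARD('n) g I"
    and "\<forall>t\<in>I. f t = A *v g t" and "invertible A" and "t \<in> I" and j: "j < CARD('n)"
  shows "Phi j f t = Phi j g t"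
proof -
  have factor: "det (cols (\<lambda>e. higher_vderiv (s e) f t)) =
      det A * det (cols (\<lambda>e. higher_vderiv (s e) g t))"
    if "\<And>e. e < CARD('n) \<Longrightarrow> s e \<le> CARD('n)" for s
  proof -
    have "cols (\<lambda>e. higher_vderiv (s e) f t) = cols (\<lambda>e. A *v higher_vderiv (s e) g t)"
      using higher_vderiv_linear_image[OF assms(1-3) _ \<open>t \<in> I\<close>] that by (intro cols_cong) auto
    then show ?thesis
      by (simp add: matrix_mult_cols[symmetric] det_mul)
  qed
  have "det A \<noteq> 0"
    using \<open>invertible A\<close> invertible_det_nz by blast
  then show ?thesis
    using factor[of "\<lambda>e. e"] factor[of "\<lambda>e. if e < j then e else Suc e"]
    by (simp add: Phi_eq_det_cols[OF j])
qed

lemma det_differentiable: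
  fixes M :: "real \<Rightarrow> real ^ 'n ^ 'n"
  assumes "\<And>i j. (\<lambda>t. M t $ i $ j) differentiable at t"
  shows "(\<lambda>t. det (M t)) differentiable at t"
proof -
  have "(\<lambda>t. \<Prod>i\<in>S. M t $ i $ p i) differentiable at t" if "finite S" for S :: "'n set" and p
    using that by induction (auto intro!: differentiable_mult assms)
  then show ?thesis
    unfolding det_def by (intro differentiable_sum differentiable_mult ballI differentiable_const) auto
qed

section \<open>Solutions of the common linear differential equation\<close>

text \<open>
  The components of \<open>g\<close> span the solutions of the equation with coefficients \<open>\<Phi>\<^sub>g\<^sup>j\<close>. Here \<open>u k\<close>
  plays the role of the \<open>k\<close>-th derivative of a solution \<open>u 0\<close>. The coefficient vector is first
  found pointwise and then shown to have zero derivative, hence to be constant on the convex set \<open>I\<close>.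
\<close>

lemma ode_solution_linear_combination:
  fixes g :: "real \<Rightarrow> real ^ 'n::{finite,linorder}" and u :: "nat \<Rightarrow> real \<Rightarrow> real"
  assumes I: "open I" "convex I" and g: "cont_differentiable_on CARD('n) g I"
    and W: "\<And>t. t \<in> I \<Longrightarrow> wronskian g t \<noteq> 0"
    and u: "\<And>k t. k < CARD('n) \<Longrightarrow> t \<in> I \<Longrightarrow> (u k has_real_derivative u (Suc k) t) (at t)"
    and ode: "\<And>t. t \<in> I \<Longrightarrow> u CARD('n) t = (\<Sum>j<CARD('n). Phi j g t * u j t)"
  obtains a where "\<And>k t. k < CARD('n) \<Longrightarrow> t \<in> I \<Longrightarrow> u k t = higher_vderiv k g t \<bullet> a"
proof -
  define G where "G t = Finite_Cartesian_Product.transpose (cols (\<lambda>e. higher_vderiv e g t))" for t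
  define b where "b t = (\<chi> c::'n. u (deriv_order c) t)" for t
  define a where "a t = (\<chi> k. det (\<chi> i j. if j = k then b t $ i else G t $ i $ j) / det (G t))" for t
  have detG: "det (G t) \<noteq> 0" if "t \<in> I" for t
    using W[OF that] by (simp add: G_def det_transpose wronskian_eq_det_cols)
  have eq: "u k t = higher_vderiv k g t \<bullet> a t" if k: "k < CARD('n)" and t: "t \<in> I" for k t
  proof -
    obtain c :: 'n where c: "deriv_order c = k"
      using deriv_order_surj k by blast
    have "G t *v a t = b t"
      unfolding cramer[OF detG[OF t]] a_def ..
    then have "(G t *v a t) $ c = b t $ c"
      by simp
    then show ?thesis
      unfolding G_def transpose_cols_mult_vec by (simp add: b_def c)
  qed
  \<comment> \<open>both sides obey the same expansion in lower orders, with coefficients \<open>\<Phi>\<^sub>g\<^sup>j\<close>\<close>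
  have eq_top: "u CARD('n) t = higher_vderiv CARD('n) g t \<bullet> a t" if t: "t \<in> I" for t
    using eq[OF _ t] ode[OF t]
    by (simp add: top_derivative_eq_sum_Phi[OF W[OF t]] inner_sum_left)
  have "(a has_vector_derivative 0) (at t)" if t: "t \<in> I" for t
  proof -
    have u_diff: "u k differentiable at t" if "k < CARD('n)" for k
      using u[OF that t] by (auto simp: real_differentiable_def)
    have "(\<lambda>s. higher_vderiv k g s $ r) differentiable at t" if "k < CARD('n)" for k r
      using bounded_linear.has_vector_derivative[OF bounded_linear_vec_nth
          higher_vderiv_has_vector_derivative[OF g that t]]
      by (blast intro: differentiableI_vector)
    then have G_diff: "(\<lambda>s. G s $ i $ j) differentiable at t" for i j
      by (simp add: G_def cols_def transpose_def deriv_order_less)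
    have "(\<lambda>s. a s $ k) differentiable at t" for k
      unfolding a_def vec_lambda_beta
    proof (intro differentiable_divide det_differentiable)
      show "(\<lambda>s. (\<chi> i j. if j = k then b s $ i else G s $ i $ j) $ i $ j) differentiable at t" for i j
        using u_diff[OF deriv_order_less, of i] G_diff[of i j] by (cases "j = k") (simp_all add: b_def)
    qed (use detG t G_diff in auto)
    then have "a differentiable at t"
      unfolding differentiable_componentwise_within[of a t UNIV]
      by (auto simp: Basis_vec_def inner_axis)
    then obtain a' where a': "(a has_vector_derivative a') (at t)"
      using vector_derivative_works by blast
    \<comment> \<open>the product rule for \<open>u k = g^(k) \<bullet> a\<close>, minus the relation of order \<open>k + 1\<close>\<close>
    have "higher_vderiv k g t \<bullet> a' = 0" if k: "k < CARD('n)" for k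
    proof -
      have "((\<lambda>s. higher_vderiv k g s \<bullet> a s) has_vector_derivative
          higher_vderiv k g t \<bullet> a' + higher_vderiv (Suc k) g t \<bullet> a t) (at t)"
        by (intro bounded_bilinear.has_vector_derivative[OF bounded_bilinear_inner]
            higher_vderiv_has_vector_derivative[OF g k t] a')
      then have "(u k has_vector_derivative
          higher_vderiv k g t \<bullet> a' + higher_vderiv (Suc k) g t \<bullet> a t) (at t)"
        using eq[OF k] by (elim has_vector_derivative_transform_within_open[OF _ I(1) t]) simp
      moreover have "(u k has_vector_derivative u (Suc k) t) (at t)"
        using u[OF k t] by (simp add: has_real_derivative_iff_has_vector_derivative)
      ultimately have "u (Suc k) t = higher_vderiv k g t \<bullet> a' + higher_vderiv (Suc k) g t \<bullet> a t"
        using vector_derivative_unique_at by blast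
      moreover have "u (Suc k) t = higher_vderiv (Suc k) g t \<bullet> a t"
        using k eq[OF _ t] eq_top[OF t] by (cases "Suc k = CARD('n)") auto
      ultimately show ?thesis
        by simp
    qed
    with W[OF t] have "a' = 0"
      unfolding wronskian_eq_det_cols by (rule orthogonal_to_columns_imp_zero)
    with a' show ?thesis
      by simp
  qed
  then have "\<exists>a0. \<forall>t\<in>I. a t = a0"
    using \<open>convex I\<close>
    by (intro has_derivative_zero_constant)
      (auto simp: has_vector_derivative_def intro: has_derivative_at_withinI)
  then obtain a0 where a0: "\<forall>t\<in>I. a t = a0" ..
  show ?thesis
  proof (rule that)
    fix k t assume "k < CARD('n)" "t \<in> I"
    then show "u k t = higher_vderiv k g t \<bullet> a0"
      using eq a0 by metis
  qed
qed

theorem theorem8: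
  fixes f g :: "real \<Rightarrow> real ^ ('n::{finite,linorder})" and I :: "real set"
  assumes "open I" and "is_interval I" and "I \<noteq> {}"
    and "cont_differentiable_on CARD('n) f I"
    and "cont_differentiable_on CARD('n) g I"
    and "\<forall>t\<in>I. wronskian f t \<noteq> 0"
    and "\<forall>t\<in>I. wronskian g t \<noteq> 0"
  shows "range_equivalent_on I f g \<longleftrightarrow>
    (\<forall>j\<in>{0..CARD('n) - 1}. \<forall>t\<in>I. Phi j f t = Phi j g t)"
proof
  assume "range_equivalent_on I f g"
  then obtain A where A: "invertible A" "\<forall>t\<in>I. f t = A *v g t"
    unfolding range_equivalent_on_def by blast
  show "\<forall>j\<in>{0..CARD('n) - 1}. \<forall>t\<in>I. Phi j f t = Phi j g t"
  proof (intro ballI)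
    fix j t assume j: "j \<in> {0..CARD('n) - 1}" and t: "t \<in> I"
    have "0 < CARD('n)"
      by (rule zero_less_card_finite)
    with j have "j < CARD('n)"
      unfolding atLeastAtMost_iff by linarith
    then show "Phi j f t = Phi j g t"
      by (rule Phi_linear_image[OF assms(1,5) A(2,1) t])
  qed
next
  assume Phi_eq: "\<forall>j\<in>{0..CARD('n) - 1}. \<forall>t\<in>I. Phi j f t = Phi j g t"
  have "\<exists>a. \<forall>k<CARD('n). \<forall>t\<in>I. higher_vderiv k f t $ r = higher_vderiv k g t \<bullet> a" for r
  proof -
    have u: "((\<lambda>s. higher_vderiv k f s $ r) has_real_derivative higher_vderiv (Suc k) f t $ r) (at t)"
      if "k < CARD('n)" "t \<in> I" for k t
      unfolding has_real_derivative_iff_has_vector_derivative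
      using higher_vderiv_has_vector_derivative[OF assms(4) that]
      by (rule bounded_linear.has_vector_derivative[OF bounded_linear_vec_nth])
    have ode: "higher_vderiv CARD('n) f t $ r =
        (\<Sum>j<CARD('n). Phi j g t * higher_vderiv j f t $ r)" if "t \<in> I" for t
    proof -
      have "Phi j f t = Phi j g t" if "j < CARD('n)" for j
        using Phi_eq \<open>t \<in> I\<close> that by auto
      moreover have "wronskian f t \<noteq> 0"
        using assms(6) that by blast
      ultimately show ?thesis
        by (simp add: top_derivative_eq_sum_Phi)
    qed
    have W: "wronskian g t \<noteq> 0" if "t \<in> I" for t
      using assms(7) that by blast
    show ?thesis
    proof (rule ode_solution_linear_combination[OF assms(1) is_interval_convex[OF assms(2)] assms(5)
          W u ode])
      fix a assume "\<And>k t. k < CARD('n) \<Longrightarrow> t \<in> I \<Longrightarrow>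
        higher_vderiv k f t $ r = higher_vderiv k g t \<bullet> a"
      then show ?thesis
        by (intro exI[of _ a]) simp
    qed
  qed
  then have "\<exists>a. \<forall>r. \<forall>k<CARD('n). \<forall>t\<in>I. higher_vderiv k f t $ r = higher_vderiv k g t \<bullet> a r"
    by (intro choice allI)
  then obtain a where a: "\<And>r k t. k < CARD('n) \<Longrightarrow> t \<in> I \<Longrightarrow>
      higher_vderiv k f t $ r = higher_vderiv k g t \<bullet> a r"
    by blast
  \<comment> \<open>row \<open>r\<close> holds the coefficients of the \<open>r\<close>-th component of \<open>f\<close> in terms of those of \<open>g\<close>\<close>
  define A where "A = (\<chi> r. a r)"
  have A: "higher_vderiv k f t = A *v higher_vderiv k g t" if "k < CARD('n)" "t \<in> I" for k t
    using a[OF that]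
    by (simp add: vec_eq_iff A_def matrix_vector_mult_def inner_vec_def mult.commute)
  \<comment> \<open>at a single point the relations of orders \<open>0, \<dots>, n - 1\<close> give \<open>W\<^sub>f = det A W\<^sub>g\<close>\<close>
  obtain t where t: "t \<in> I"
    using assms(3) by blast
  have "wronskian f t = det (cols (\<lambda>e. A *v higher_vderiv e g t))"
    unfolding wronskian_eq_det_cols using A t by (intro arg_cong[of _ _ det] cols_cong) simp
  also have "\<dots> = det A * wronskian g t"
    by (simp add: matrix_mult_cols[symmetric] det_mul wronskian_eq_det_cols)
  finally have "invertible A"
    using assms(6) t by (auto simp: invertible_det_nz)
  moreover have "\<forall>t\<in>I. f t = A *v g t"
    using A[of 0] by (simp add: higher_vderiv_def)
  ultimately show "range_equivalent_on I f g"
    unfolding range_equivalent_on_def by blast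
qed

end
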